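(* Let $\{(Q_\lambda,\ast_\lambda)\}_{\lambda=1,\ldots,n}$ be a finite family of nontrivial connected quandles. Let $(\bigsqcup^{\mathrm{free}}_{\lambda=1,\ldots,n}Q_\lambda,\ast_{\mathrm{free}})$ denote their interaction-free union and $(\prod_{\lambda=1}^nQ_\lambda,\ast)$ denote their direct product. Then there is a canonical bijection $$\operatorname{Good}\Bigl(\bigsqcup\nolimits^{\mathrm{free}}_{\lambda=1,\ldots,n}Q_\lambda\Bigr)\;\cong\;\operatorname{Good}\Bigl(\prod_{\lambda=1}^nQ_\lambda\Bigr)\;\cong\;\prod_{\lambda=1}^n\operatorname{Good}(Q_\lambda,\ast_\lambda).$$
   Context: A quandle is a set $Q$ with a binary operation $\ast$ such that: (1) $x\ast x=x$ for all $x$; (2) for every $y\in Q$ the map $s_y\colon Q\to Q$, $s_y(x)=x\ast y$, is invertible; (3) $(x\ast y)\ast z=(x\ast z)\ast(y\ast z)$ for all $x,y,z$. Write $x\ast^{-1}y:=s_y^{-1}(x)$. A quandle is trivial if $x\ast y=x$ for all $x,y$, and nontrivial otherwise. A quandle is connected if its inner automorphism group, the group of bijections of $Q$ generated by $\{s_y\mid y\in Q\}$, acts transitively on $Q$. A good involution on $(Q,\ast)$ is a map $\rho\colon Q\to Q$ with $\rho\circ\rho=\mathrm{id}_Q$, $\rho(x\ast y)=\rho(x)\ast y$ and $x\ast\rho(y)=x\ast^{-1}y$ for all $x,y\in Q$; $\operatorname{Good}(Q,\ast)$ is the set of good involutions. The interaction-free union is the disjoint union $\bigsqcup_\lambda Q_\lambda$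 with $x\ast_{\mathrm{free}}y=x\ast_\lambda y$ if $x,y\in Q_\lambda$ for some $\lambda$, and $x\ast_{\mathrm{free}}y=x$ otherwise. The direct product is the Cartesian product with the componentwise operation. Both are quandles. *)

theory Defs
  imports "HOL-Algebra.Group_Action" "HOL-Algebra.Generated_Groups"
begin

record 'a quandle_struct = "'a partial_object" +
  qop :: "['a, 'a] \<Rightarrow> 'a"  (infixl \<open>\<star>\<index>\<close> 70)

locale quandle =
  fixes Q :: "'a quandle_struct" (structure)
  assumes closed: "\<lbrakk>x \<in> carrier Q; y \<in> carrier Q\<rbrakk> \<Longrightarrow> x \<star> y \<in> carrier Q"
    and idem: "x \<in> carrier Q \<Longrightarrow> x \<star> x = x"
    and right_invertible: "y \<in> carrier Q \<Longrightarrow> bij_betw (\<lambda>x. x \<star> y) (carrier Q) (carrier Q)"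
    and self_distrib: "\<lbrakk>x \<in> carrier Q; y \<in> carrier Q; z \<in> carrier Q\<rbrakk> \<Longrightarrow>
      (x \<star> y) \<star> z = (x \<star> z) \<star> (y \<star> z)"

definition symm :: "'a quandle_struct \<Rightarrow> 'a \<Rightarrow> 'a \<Rightarrow> 'a" where
  "symm Q y = (\<lambda>x \<in> carrier Q. x \<star>\<^bsub>Q\<^esub> y)"

definition qop_inv :: "'a quandle_struct \<Rightarrow> 'a \<Rightarrow> 'a \<Rightarrow> 'a" where
  "qop_inv Q x y = inv_into (carrier Q) (symm Q y) x"

definition trivial_quandle :: "'a quandle_struct \<Rightarrow> bool" where
  "trivial_quandle Q \<longleftrightarrow> (\<forall>x \<in> carrier Q. \<forall>y \<in> carrier Q. x \<star>\<^bsub>Q\<^esub> y = x)"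

definition Inn :: "'a quandle_struct \<Rightarrow> ('a \<Rightarrow> 'a) monoid" where
  "Inn Q = (BijGroup (carrier Q))
     \<lparr>carrier := generate (BijGroup (carrier Q)) (symm Q ` carrier Q)\<rparr>"

definition connected_quandle :: "'a quandle_struct \<Rightarrow> bool" where
  "connected_quandle Q \<longleftrightarrow> transitive_action (Inn Q) (carrier Q) (\<lambda>g. g)"

text \<open>Maps on a carrier are taken to be extensional, so that equality in \<open>Good Q\<close> is
  equality on the carrier and bijections with \<open>Good Q\<close> are meaningful.\<close>

definition Good :: "'a quandle_struct \<Rightarrow> ('a \<Rightarrow> 'a) set" where
  "Good Q = {\<rho> \<in> carrier Q \<rightarrow>\<^sub>E carrier Q.
     (\<forall>x \<in> carrier Q. \<rho> (\<rho> x) = x) \<and>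
     (\<forall>x \<in> carrier Q. \<forall>y \<in> carrier Q. \<rho> (x \<star>\<^bsub>Q\<^esub> y) = \<rho> x \<star>\<^bsub>Q\<^esub> y) \<and>
     (\<forall>x \<in> carrier Q. \<forall>y \<in> carrier Q. x \<star>\<^bsub>Q\<^esub> \<rho> y = qop_inv Q x y)}"

definition free_union :: "'i set \<Rightarrow> ('i \<Rightarrow> 'a quandle_struct) \<Rightarrow> ('i \<times> 'a) quandle_struct" where
  "free_union I Q = \<lparr>carrier = (SIGMA i:I. carrier (Q i)),
     qop = (\<lambda>(i, x) (j, y). (i, if i = j then x \<star>\<^bsub>Q i\<^esub> y else x))\<rparr>"

definition product_quandle ::
  "'i set \<Rightarrow> ('i \<Rightarrow> 'a quandle_struct) \<Rightarrow> ('i \<Rightarrow> 'a) quandle_struct" where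
  "product_quandle I Q = \<lparr>carrier = (\<Pi>\<^sub>E i\<in>I. carrier (Q i)),
     qop = (\<lambda>x y. \<lambda>i\<in>I. x i \<star>\<^bsub>Q i\<^esub> y i)\<rparr>"

text \<open>The canonical maps: a family \<open>\<rho> i\<close> of good involutions acts summandwise on the
  interaction-free union and componentwise on the product; a good involution of the union
  induces, through its restrictions to the summands, a map on the product.\<close>

definition family_to_union ::
  "'i set \<Rightarrow> ('i \<Rightarrow> 'a quandle_struct) \<Rightarrow> ('i \<Rightarrow> 'a \<Rightarrow> 'a) \<Rightarrow> 'i \<times> 'a \<Rightarrow> 'i \<times> 'a" where
  "family_to_union I Q \<rho> = (\<lambda>(i, x) \<in> carrier (free_union I Q). (i, \<rho> i x))"

definition family_to_product ::
  "'i set \<Rightarrow> ('i \<Rightarrow> 'a quandle_struct) \<Rightarrow> ('i \<Rightarrow> 'a \<Rightarrow> 'a) \<Rightarrow> ('i \<Rightarrow> 'a) \<Rightarrow> 'i \<Rightarrow> 'a" where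
  "family_to_product I Q \<rho> = (\<lambda>x \<in> carrier (product_quandle I Q). \<lambda>i\<in>I. \<rho> i (x i))"

definition union_to_product ::
  "'i set \<Rightarrow> ('i \<Rightarrow> 'a quandle_struct) \<Rightarrow> ('i \<times> 'a \<Rightarrow> 'i \<times> 'a) \<Rightarrow> ('i \<Rightarrow> 'a) \<Rightarrow> 'i \<Rightarrow> 'a" where
  "union_to_product I Q \<rho> = (\<lambda>x \<in> carrier (product_quandle I Q). \<lambda>i\<in>I. snd (\<rho> (i, x i)))"

end

theory Submission
  imports Defs
begin

text \<open>
  The last two axioms of a good involution say that \<open>\<rho>\<close> commutes with all the maps \<open>s\<^sub>y\<close>, hence with
  inner automorphisms, and that \<open>s\<close> at \<open>\<rho> y\<close> is the inverse of \<open>s\<^sub>y\<close>. In both constructions the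
  axioms for a family \<open>\<rho> i\<close> are checked coordinate by coordinate, and a family is recovered from the
  map it induces; for the product, this is because no \<open>Q i\<close> is empty. The content is that every good
  involution arises from a family, and connectedness enters through
  \<open>connected_quandle_invariant_set\<close>: in a connected quandle a nonempty set \<open>S\<close> such that \<open>c \<in> S\<close>
  is equivalent to \<open>c \<star> d \<in> S\<close> is everything.

  \<^item> Union. If \<open>\<rho> (i, x)\<close> lay in another summand, then every element \<open>(i, d)\<close> would fix it, and since
    \<open>\<rho>\<close> is injective and commutes with \<open>s\<close> at \<open>(i, d)\<close>, every \<open>d\<close> would fix \<open>x\<close>. Then \<open>{x}\<close> is
    invariant, so \<open>Q i\<close> is a point and thus trivial. Hence \<open>\<rho>\<close> preserves the summands
    (\<open>Good_free_union_fst\<close>).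

  \<^item> Product. The \<open>i\<close>-th coordinate of \<open>\<rho> x\<close> depends on \<open>x i\<close> only. Replacing one coordinate \<open>x j\<close>
    with \<open>j \<noteq> i\<close> by \<open>x j \<star> d\<close> amounts to acting on \<open>x\<close> by \<open>x(j := d)\<close>, since the other coordinates
    act on themselves. So \<open>\<rho> x\<close> changes by the same action, whose effect on the \<open>i\<close>-th coordinate is
    that of \<open>x\<close> itself; and \<open>\<rho> x \<star> x = \<rho> (x \<star> x) = \<rho> x\<close>. By connectedness of \<open>Q j\<close>, any change of
    the \<open>j\<close>-th coordinate is harmless (\<open>Good_product_change_coordinate\<close>), and finitely many
    such changes join any two points with the same \<open>i\<close>-th coordinate.

  The bijection between the union and the product follows, since the three canonical maps form a
  commuting triangle.
\<close>

section \<open>Quandles, inverse translations and good involutions\<close>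

lemma (in quandle) qop_inv_closed:
  assumes "x \<in> carrier Q" "y \<in> carrier Q"
  shows "qop_inv Q x y \<in> carrier Q"
proof -
  have "symm Q y ` carrier Q = carrier Q"
    using right_invertible[OF assms(2)] by (simp add: symm_def bij_betw_def)
  then show ?thesis
    using assms(1) unfolding qop_inv_def by (metis inv_into_into)
qed

lemma (in quandle) qop_inv_cancel_right:
  assumes "x \<in> carrier Q" "y \<in> carrier Q"
  shows "qop_inv Q x y \<star> y = x"
proof -
  have "symm Q y ` carrier Q = carrier Q"
    using right_invertible[OF assms(2)] by (simp add: symm_def bij_betw_def)
  then have "symm Q y (qop_inv Q x y) = x"
    using assms(1) unfolding qop_inv_def by (metis f_inv_into_f)
  then show ?thesis
    using qop_inv_closed[OF assms] by (simp add: symm_def)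
qed

lemma (in quandle) right_cancel:
  assumes "x \<in> carrier Q" "x' \<in> carrier Q" "y \<in> carrier Q" "x \<star> y = x' \<star> y"
  shows "x = x'"
  using right_invertible[OF assms(3)] assms by (auto simp: bij_betw_def dest: inj_onD)

lemma (in quandle) eq_qop_inv_iff:
  assumes "x \<in> carrier Q" "y \<in> carrier Q" "z \<in> carrier Q"
  shows "z = qop_inv Q x y \<longleftrightarrow> z \<star> y = x"
  using qop_inv_cancel_right[OF assms(1,2)]
    right_cancel[OF assms(3) qop_inv_closed[OF assms(1,2)] assms(2)] by auto

text \<open>A formula for the inverse translations is the practical way to verify bijectivity in the
  constructions below.\<close>

lemma bij_betw_translation_if_inverse:
  assumes "\<And>x. x \<in> A \<Longrightarrow> f x \<in> A" "\<And>x. x \<in> A \<Longrightarrow> g x \<in> A"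
    and "\<And>x. x \<in> A \<Longrightarrow> f (g x) = x" "\<And>x. x \<in> A \<Longrightarrow> g (f x) = x"
  shows "bij_betw f A A"
  by (rule bij_betw_byWitness[where f' = g]) (use assms in auto)

text \<open>Eliminating \<open>qop_inv\<close> from the last axiom makes all axioms equations in the
  operation itself, which are checked coordinatewise without computing inverses.\<close>

lemma (in quandle) Good_iff:
  "\<rho> \<in> Good Q \<longleftrightarrow> \<rho> \<in> carrier Q \<rightarrow>\<^sub>E carrier Q \<and>
     (\<forall>x \<in> carrier Q. \<rho> (\<rho> x) = x) \<and>
     (\<forall>x \<in> carrier Q. \<forall>y \<in> carrier Q. \<rho> (x \<star> y) = \<rho> x \<star> y) \<and>
     (\<forall>x \<in> carrier Q. \<forall>y \<in> carrier Q. (x \<star> \<rho> y) \<star> y = x)"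
proof -
  have "x \<star> \<rho> y = qop_inv Q x y \<longleftrightarrow> (x \<star> \<rho> y) \<star> y = x"
    if "\<rho> \<in> carrier Q \<rightarrow>\<^sub>E carrier Q" "x \<in> carrier Q" "y \<in> carrier Q" for x y
    using that by (intro eq_qop_inv_iff closed) auto
  then show ?thesis
    unfolding Good_def by (simp cong: conj_cong ball_cong)
qed

lemma Good_closed: "\<rho> \<in> Good Q \<Longrightarrow> x \<in> carrier Q \<Longrightarrow> \<rho> x \<in> carrier Q"
  by (auto simp: Good_def)

lemma Good_involutive: "\<rho> \<in> Good Q \<Longrightarrow> x \<in> carrier Q \<Longrightarrow> \<rho> (\<rho> x) = x"
  by (auto simp: Good_def)

lemma Good_commute:
  "\<rho> \<in> Good Q \<Longrightarrow> x \<in> carrier Q \<Longrightarrow> y \<in> carrier Q \<Longrightarrow> \<rho> (x \<star>\<^bsub>Q\<^esub> y) = \<rho> x \<star>\<^bsub>Q\<^esub> y"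
  by (auto simp: Good_def)

lemma (in quandle) Good_cancel:
  "\<rho> \<in> Good Q \<Longrightarrow> x \<in> carrier Q \<Longrightarrow> y \<in> carrier Q \<Longrightarrow> (x \<star> \<rho> y) \<star> y = x"
  by (auto simp: Good_iff)

section \<open>Invariant subsets of connected quandles\<close>

text \<open>The bijections preserving \<open>S\<close> in both directions form a group. It contains the translations,
  so it contains the inner automorphism group, whose only orbit is then contained in \<open>S\<close>.\<close>

lemma connected_quandle_invariant_set:
  assumes "quandle Q" and conn: "connected_quandle Q"
    and inv: "\<And>c d. c \<in> carrier Q \<Longrightarrow> d \<in> carrier Q \<Longrightarrow> c \<star>\<^bsub>Q\<^esub> d \<in> S \<longleftrightarrow> c \<in> S"
    and a: "a \<in> carrier Q" "a \<in> S" and b: "b \<in> carrier Q"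
  shows "b \<in> S"
proof -
  interpret quandle Q by fact
  let ?C = "carrier Q"
  have symm_Bij: "symm Q y \<in> Bij ?C" if "y \<in> ?C" for y
    using right_invertible[OF that] by (simp add: symm_def Bij_def)
  have key: "g \<in> Bij ?C \<and> (\<forall>x \<in> ?C. g x \<in> S \<longleftrightarrow> x \<in> S)"
    if "g \<in> generate (BijGroup ?C) (symm Q ` ?C)" for g
    using that
  proof (induction rule: generate.induct)
    case one
    have "\<one>\<^bsub>BijGroup ?C\<^esub> = (\<lambda>x\<in>?C. x)" by (simp add: BijGroup_def)
    then show ?case using id_Bij[of ?C] by (metis restrict_apply')
  next
    case (incl h)
    then show ?case using symm_Bij inv by (auto simp: symm_def)
  next
    case (inv h)
    then obtain y where y: "y \<in> ?C" "h = symm Q y" by auto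
    have h_inv: "inv\<^bsub>BijGroup ?C\<^esub> h = (\<lambda>x\<in>?C. qop_inv Q x y)"
      using symm_Bij[OF y(1)] y(2) by (simp add: inv_BijGroup qop_inv_def)
    have "qop_inv Q x y \<in> S \<longleftrightarrow> x \<in> S" if "x \<in> ?C" for x
      using assms(3)[OF qop_inv_closed[OF that y(1)] y(1)] qop_inv_cancel_right[OF that y(1)]
      by simp
    moreover have "inv\<^bsub>BijGroup ?C\<^esub> h \<in> Bij ?C"
      using symm_Bij[OF y(1)] y(2) by (simp add: inv_BijGroup restrict_inv_into_Bij)
    ultimately show ?case by (metis h_inv restrict_apply')
  next
    case (eng h1 h2)
    then have h: "h1 \<in> Bij ?C" "h2 \<in> Bij ?C"
      and S: "\<forall>x \<in> ?C. h1 x \<in> S \<longleftrightarrow> x \<in> S" "\<forall>x \<in> ?C. h2 x \<in> S \<longleftrightarrow> x \<in> S"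
      by auto
    have prod: "h1 \<otimes>\<^bsub>BijGroup ?C\<^esub> h2 = compose ?C h1 h2"
      using h by (simp add: BijGroup_def)
    show ?case
      unfolding prod using compose_Bij[OF h] S funcset_mem[OF Bij_imp_funcset[OF h(2)]]
      by (simp add: compose_eq)
  qed
  interpret transitive_action "Inn Q" ?C "\<lambda>g. g"
    using conn by (simp add: connected_quandle_def)
  obtain g where "g \<in> carrier (Inn Q)" "g a = b"
    using unique_orbit[OF a(1) b] by auto
  then show ?thesis
    using key[of g] a by (auto simp: Inn_def)
qed

lemma connected_quandle_fixed_point:
  assumes "quandle Q" "connected_quandle Q" "x \<in> carrier Q"
    and fixed: "\<And>d. d \<in> carrier Q \<Longrightarrow> x \<star>\<^bsub>Q\<^esub> d = x"
  shows "trivial_quandle Q"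
proof -
  interpret quandle Q by fact
  have "c \<star>\<^bsub>Q\<^esub> d \<in> {x} \<longleftrightarrow> c \<in> {x}" if "c \<in> carrier Q" "d \<in> carrier Q" for c d
    using fixed[OF that(2)] right_cancel[OF that(1) assms(3) that(2)] by auto
  from connected_quandle_invariant_set[OF assms(1,2) this assms(3)]
  have "carrier Q = {x}" using assms(3) by blast
  then show ?thesis
    using fixed by (simp add: trivial_quandle_def)
qed

lemma nontrivial_quandle_nonempty: "\<not> trivial_quandle Q \<Longrightarrow> carrier Q \<noteq> {}"
  by (auto simp: trivial_quandle_def)

section \<open>Good involutions of the interaction-free union\<close>

lemma free_union_simps:
  "carrier (free_union I Q) = (SIGMA i:I. carrier (Q i))"
  "(i, x) \<star>\<^bsub>free_union I Q\<^esub> (j, y) = (i, if i = j then x \<star>\<^bsub>Q i\<^esub> y else x)"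
  by (simp_all add: free_union_def)

lemma quandle_free_union:
  assumes "\<And>i. i \<in> I \<Longrightarrow> quandle (Q i)"
  shows "quandle (free_union I Q)"
proof
  show "bij_betw (\<lambda>x. x \<star>\<^bsub>free_union I Q\<^esub> y) (carrier (free_union I Q)) (carrier (free_union I Q))"
    if y_in: "y \<in> carrier (free_union I Q)" for y
  proof -
    obtain j b where y: "y = (j, b)" "j \<in> I" "b \<in> carrier (Q j)"
      using y_in by (auto simp: free_union_simps)
    interpret j: quandle "Q j" using assms y by auto
    have cancel: "qop_inv (Q j) (a \<star>\<^bsub>Q j\<^esub> b) b = a" if "a \<in> carrier (Q j)" for a
      using j.eq_qop_inv_iff[OF j.closed[OF that y(3)] y(3) that] by simp
    show ?thesis
      unfolding y(1)
      by (rule bij_betw_translation_if_inverse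
            [where g = "\<lambda>(i, a). (i, if i = j then qop_inv (Q i) a b else a)"])
         (use y cancel j.qop_inv_closed j.qop_inv_cancel_right j.closed in \<open>auto simp: free_union_simps\<close>)
  qed
  show "(x \<star>\<^bsub>free_union I Q\<^esub> y) \<star>\<^bsub>free_union I Q\<^esub> z =
      (x \<star>\<^bsub>free_union I Q\<^esub> z) \<star>\<^bsub>free_union I Q\<^esub> (y \<star>\<^bsub>free_union I Q\<^esub> z)"
    if "x \<in> carrier (free_union I Q)" "y \<in> carrier (free_union I Q)" "z \<in> carrier (free_union I Q)"
    for x y z
    using that by (auto simp: free_union_simps quandle.self_distrib[OF assms, symmetric])
qed (use assms in \<open>auto simp: free_union_simps quandle.closed quandle.idem\<close>)

lemma family_to_union_apply:
  "i \<in> I \<Longrightarrow> x \<in> carrier (Q i) \<Longrightarrow> family_to_union I Q \<rho> (i, x) = (i, \<rho> i x)"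
  by (simp add: family_to_union_def free_union_simps)

lemma family_to_union_Good:
  assumes quandle: "\<And>i. i \<in> I \<Longrightarrow> quandle (Q i)" and \<rho>: "\<rho> \<in> (\<Pi>\<^sub>E i\<in>I. Good (Q i))"
  shows "family_to_union I Q \<rho> \<in> Good (free_union I Q)"
proof -
  interpret U: quandle "free_union I Q" using quandle_free_union quandle by blast
  have good: "\<rho> i \<in> Good (Q i)" if "i \<in> I" for i using \<rho> that by auto
  let ?F = "family_to_union I Q \<rho>"
  show ?thesis
    unfolding U.Good_iff
  proof (intro conjI ballI)
    show "?F \<in> carrier (free_union I Q) \<rightarrow>\<^sub>E carrier (free_union I Q)"
      unfolding PiE_def
      by (auto simp: family_to_union_apply free_union_simps Good_closed[OF good])
        (simp add: family_to_union_def free_union_simps)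
    fix p assume "p \<in> carrier (free_union I Q)"
    then obtain i x where p: "p = (i, x)" "i \<in> I" "x \<in> carrier (Q i)"
      by (auto simp: free_union_simps)
    show "?F (?F p) = p"
      using p by (simp add: family_to_union_apply Good_closed[OF good] Good_involutive[OF good])
    fix q assume "q \<in> carrier (free_union I Q)"
    then obtain j y where q: "q = (j, y)" "j \<in> I" "y \<in> carrier (Q j)"
      by (auto simp: free_union_simps)
    show "?F (p \<star>\<^bsub>free_union I Q\<^esub> q) = ?F p \<star>\<^bsub>free_union I Q\<^esub> q"
      using p q by (cases "i = j") (simp_all add: family_to_union_apply free_union_simps
          Good_commute[OF good] quandle.closed[OF quandle])
    show "(p \<star>\<^bsub>free_union I Q\<^esub> ?F q) \<star>\<^bsub>free_union I Q\<^esub> q = p"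
      using p q by (auto simp: family_to_union_apply free_union_simps
          quandle.Good_cancel[OF quandle good])
  qed
qed

lemma Good_free_union_fst:
  assumes quandle: "\<And>i. i \<in> I \<Longrightarrow> quandle (Q i)"
    and "\<not> trivial_quandle (Q i)" "connected_quandle (Q i)"
    and \<sigma>: "\<sigma> \<in> Good (free_union I Q)" and i: "i \<in> I" and x: "x \<in> carrier (Q i)"
  shows "fst (\<sigma> (i, x)) = i"
proof (rule ccontr)
  assume other: "fst (\<sigma> (i, x)) \<noteq> i"
  have "x \<star>\<^bsub>Q i\<^esub> d = x" if d: "d \<in> carrier (Q i)" for d
  proof -
    have xd: "x \<star>\<^bsub>Q i\<^esub> d \<in> carrier (Q i)"
      using quandle.closed[OF quandle[OF i] x d] .
    have "\<sigma> (i, x \<star>\<^bsub>Q i\<^esub> d) = \<sigma> (i, x) \<star>\<^bsub>free_union I Q\<^esub> (i, d)"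
      using Good_commute[OF \<sigma>, of "(i, x)" "(i, d)"] i x d by (simp add: free_union_simps)
    also have "\<dots> = \<sigma> (i, x)"
      using other by (cases "\<sigma> (i, x)") (simp add: free_union_simps)
    finally have "\<sigma> (\<sigma> (i, x \<star>\<^bsub>Q i\<^esub> d)) = \<sigma> (\<sigma> (i, x))" by simp
    then show ?thesis
      using Good_involutive[OF \<sigma>] i x xd by (simp add: free_union_simps)
  qed
  then show False
    using connected_quandle_fixed_point[OF quandle[OF i] assms(3) x] assms(2) by blast
qed

text \<open>Once the summands are preserved, every axiom for \<open>\<sigma>\<close> restricts to each of them.\<close>

lemma Good_free_union_restrict:
  assumes quandle: "\<And>i. i \<in> I \<Longrightarrow> quandle (Q i)"
    and \<sigma>: "\<sigma> \<in> Good (free_union I Q)" and i: "i \<in> I"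
    and preserve: "\<And>x. x \<in> carrier (Q i) \<Longrightarrow> fst (\<sigma> (i, x)) = i"
  shows "(\<lambda>x \<in> carrier (Q i). snd (\<sigma> (i, x))) \<in> Good (Q i)"
proof -
  interpret U: quandle "free_union I Q" using quandle_free_union quandle by blast
  interpret i: quandle "Q i" using quandle i by blast
  define \<tau> where "\<tau> x = snd (\<sigma> (i, x))" for x
  have \<sigma>_eq: "\<sigma> (i, x) = (i, \<tau> x)" if "x \<in> carrier (Q i)" for x
    using preserve[OF that] by (simp add: \<tau>_def prod_eq_iff)
  have in_U: "(i, x) \<in> carrier (free_union I Q)" if "x \<in> carrier (Q i)" for x
    using that i by (simp add: free_union_simps)
  have closed: "\<tau> x \<in> carrier (Q i)" if "x \<in> carrier (Q i)" for x
    using Good_closed[OF \<sigma> in_U[OF that]] \<sigma>_eq[OF that] by (simp add: free_union_simps)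
  have invol: "\<tau> (\<tau> x) = x" if "x \<in> carrier (Q i)" for x
    using Good_involutive[OF \<sigma> in_U[OF that]] that closed by (simp add: \<sigma>_eq)
  have commute: "\<tau> (x \<star>\<^bsub>Q i\<^esub> y) = \<tau> x \<star>\<^bsub>Q i\<^esub> y" if "x \<in> carrier (Q i)" "y \<in> carrier (Q i)" for x y
    using Good_commute[OF \<sigma> in_U[OF that(1)] in_U[OF that(2)]] that i.closed
    by (simp add: \<sigma>_eq free_union_simps)
  have cancel: "(x \<star>\<^bsub>Q i\<^esub> \<tau> y) \<star>\<^bsub>Q i\<^esub> y = x" if "x \<in> carrier (Q i)" "y \<in> carrier (Q i)" for x y
    using U.Good_cancel[OF \<sigma> in_U[OF that(1)] in_U[OF that(2)]] that
    by (simp add: \<sigma>_eq free_union_simps)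
  show ?thesis
    unfolding \<tau>_def[symmetric] i.Good_iff
    using closed invol commute cancel i.closed by auto
qed

theorem family_to_union_bij:
  assumes quandle: "\<And>i. i \<in> I \<Longrightarrow> quandle (Q i)"
    and nontriv: "\<And>i. i \<in> I \<Longrightarrow> \<not> trivial_quandle (Q i)"
    and conn: "\<And>i. i \<in> I \<Longrightarrow> connected_quandle (Q i)"
  shows "bij_betw (family_to_union I Q) (\<Pi>\<^sub>E i\<in>I. Good (Q i)) (Good (free_union I Q))"
proof (rule bij_betwI[where g = "\<lambda>\<sigma>. \<lambda>i\<in>I. \<lambda>x\<in>carrier (Q i). snd (\<sigma> (i, x))"])
  have preserve: "fst (\<sigma> (i, x)) = i"
    if "\<sigma> \<in> Good (free_union I Q)" "i \<in> I" "x \<in> carrier (Q i)" for \<sigma> i x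
    using Good_free_union_fst[of I Q i \<sigma> x] quandle nontriv conn that by blast
  show "family_to_union I Q \<in> (\<Pi>\<^sub>E i\<in>I. Good (Q i)) \<rightarrow> Good (free_union I Q)"
    using family_to_union_Good quandle by blast
  show "(\<lambda>\<sigma>. \<lambda>i\<in>I. \<lambda>x\<in>carrier (Q i). snd (\<sigma> (i, x))) \<in> Good (free_union I Q) \<rightarrow> (\<Pi>\<^sub>E i\<in>I. Good (Q i))"
    using Good_free_union_restrict[of I Q] quandle preserve by auto
  show "(\<lambda>i\<in>I. \<lambda>x\<in>carrier (Q i). snd (family_to_union I Q \<rho> (i, x))) = \<rho>"
    if "\<rho> \<in> (\<Pi>\<^sub>E i\<in>I. Good (Q i))" for \<rho>
  proof
    fix i
    show "(\<lambda>i\<in>I. \<lambda>x\<in>carrier (Q i). snd (family_to_union I Q \<rho> (i, x))) i = \<rho> i"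
    proof (cases "i \<in> I")
      case True
      then have "\<rho> i \<in> extensional (carrier (Q i))"
        using that by (auto simp: Good_def PiE_def Pi_def)
      then show ?thesis
        using True by (auto simp: family_to_union_apply extensional_def fun_eq_iff)
    next
      case False
      then show ?thesis using that by auto
    qed
  qed
  show "family_to_union I Q (\<lambda>i\<in>I. \<lambda>x\<in>carrier (Q i). snd (\<sigma> (i, x))) = \<sigma>"
    if \<sigma>: "\<sigma> \<in> Good (free_union I Q)" for \<sigma>
  proof (rule extensionalityI[where A = "carrier (free_union I Q)"])
    show "\<sigma> \<in> extensional (carrier (free_union I Q))"
      using \<sigma> by (simp add: Good_def PiE_def)
    show "family_to_union I Q (\<lambda>i\<in>I. \<lambda>x\<in>carrier (Q i). snd (\<sigma> (i, x)))
        \<in> extensional (carrier (free_union I Q))"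
      by (simp add: family_to_union_def)
    fix p assume "p \<in> carrier (free_union I Q)"
    then obtain i x where p: "p = (i, x)" "i \<in> I" "x \<in> carrier (Q i)"
      by (auto simp: free_union_simps)
    then show "family_to_union I Q (\<lambda>i\<in>I. \<lambda>x\<in>carrier (Q i). snd (\<sigma> (i, x))) p = \<sigma> p"
      using preserve[OF \<sigma> p(2,3)] by (cases "\<sigma> (i, x)") (simp add: family_to_union_apply)
  qed
qed

section \<open>Good involutions of the product\<close>

lemma product_quandle_simps:
  "carrier (product_quandle I Q) = (\<Pi>\<^sub>E i\<in>I. carrier (Q i))"
  "x \<star>\<^bsub>product_quandle I Q\<^esub> y = (\<lambda>i\<in>I. x i \<star>\<^bsub>Q i\<^esub> y i)"
  by (simp_all add: product_quandle_def)

lemma quandle_product: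
  assumes "\<And>i. i \<in> I \<Longrightarrow> quandle (Q i)"
  shows "quandle (product_quandle I Q)"
proof
  let ?P = "product_quandle I Q"
  show "bij_betw (\<lambda>x. x \<star>\<^bsub>?P\<^esub> y) (carrier ?P) (carrier ?P)" if y: "y \<in> carrier ?P" for y
  proof (rule bij_betw_translation_if_inverse
            [where g = "\<lambda>x. \<lambda>i\<in>I. qop_inv (Q i) (x i) (y i)"])
    fix x assume x: "x \<in> carrier ?P"
    have c: "x i \<in> carrier (Q i)" "y i \<in> carrier (Q i)" if "i \<in> I" for i
      using x y that by (auto simp: product_quandle_simps)
    show "x \<star>\<^bsub>?P\<^esub> y \<in> carrier ?P"
      using assms c by (auto simp: product_quandle_simps quandle.closed)
    show "(\<lambda>i\<in>I. qop_inv (Q i) (x i) (y i)) \<in> carrier ?P"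
      using assms c by (auto simp: product_quandle_simps quandle.qop_inv_closed)
    have "(\<lambda>i\<in>I. qop_inv (Q i) (x i) (y i) \<star>\<^bsub>Q i\<^esub> y i) = (\<lambda>i\<in>I. x i)"
      using assms c by (auto simp: quandle.qop_inv_cancel_right)
    then show "(\<lambda>i\<in>I. qop_inv (Q i) (x i) (y i)) \<star>\<^bsub>?P\<^esub> y = x"
      using x by (simp add: product_quandle_simps PiE_restrict cong: restrict_cong)
    have "qop_inv (Q i) (x i \<star>\<^bsub>Q i\<^esub> y i) (y i) = x i" if "i \<in> I" for i
      using quandle.eq_qop_inv_iff[OF assms[OF that] quandle.closed[OF assms[OF that] c[OF that]]
          c(2)[OF that] c(1)[OF that]] by simp
    then have "(\<lambda>i\<in>I. qop_inv (Q i) (x i \<star>\<^bsub>Q i\<^esub> y i) (y i)) = (\<lambda>i\<in>I. x i)" by auto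
    then show "(\<lambda>i\<in>I. qop_inv (Q i) ((x \<star>\<^bsub>?P\<^esub> y) i) (y i)) = x"
      using x by (simp add: product_quandle_simps PiE_restrict cong: restrict_cong)
  qed
  show "x \<star>\<^bsub>?P\<^esub> x = x" if x: "x \<in> carrier ?P" for x
  proof -
    have "x i \<star>\<^bsub>Q i\<^esub> x i = x i" if "i \<in> I" for i
      using x that by (intro quandle.idem assms) (auto simp: product_quandle_simps)
    then have "(\<lambda>i\<in>I. x i \<star>\<^bsub>Q i\<^esub> x i) = (\<lambda>i\<in>I. x i)" by auto
    then show ?thesis
      using x by (simp add: product_quandle_simps PiE_restrict)
  qed
qed (use assms in \<open>auto simp: product_quandle_simps quandle.closed PiE_iff
        intro!: restrict_ext quandle.self_distrib\<close>)

lemma family_to_product_apply: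
  "x \<in> carrier (product_quandle I Q) \<Longrightarrow> family_to_product I Q \<rho> x = (\<lambda>i\<in>I. \<rho> i (x i))"
  by (simp add: family_to_product_def)

lemma family_to_product_Good:
  assumes quandle: "\<And>i. i \<in> I \<Longrightarrow> quandle (Q i)" and \<rho>: "\<rho> \<in> (\<Pi>\<^sub>E i\<in>I. Good (Q i))"
  shows "family_to_product I Q \<rho> \<in> Good (product_quandle I Q)"
proof -
  let ?P = "product_quandle I Q" and ?F = "family_to_product I Q \<rho>"
  interpret P: quandle ?P using quandle_product quandle by blast
  have good: "\<rho> i \<in> Good (Q i)" if "i \<in> I" for i using \<rho> that by auto
  have coord: "x i \<in> carrier (Q i)" if "x \<in> carrier ?P" "i \<in> I" for x i
    using that by (auto simp: product_quandle_simps)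
  have ext: "x = y" if "x \<in> carrier ?P" "y \<in> carrier ?P" "\<And>i. i \<in> I \<Longrightarrow> x i = y i" for x y
    using that unfolding product_quandle_simps by (rule PiE_ext)
  have F: "?F x \<in> carrier ?P" if "x \<in> carrier ?P" for x
    using coord[OF that] good by (auto simp: family_to_product_apply[OF that] product_quandle_simps
        Good_closed)
  have F_coord: "?F x i = \<rho> i (x i)" if "x \<in> carrier ?P" "i \<in> I" for x i
    using that by (simp add: family_to_product_apply)
  have op_coord: "(x \<star>\<^bsub>?P\<^esub> y) i = x i \<star>\<^bsub>Q i\<^esub> y i" if "i \<in> I" for x y i
    using that by (simp add: product_quandle_simps)
  show ?thesis
    unfolding P.Good_iff
  proof (intro conjI ballI)
    show "?F \<in> carrier ?P \<rightarrow>\<^sub>E carrier ?P"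
      using F by (auto simp: family_to_product_def)
    fix x assume x: "x \<in> carrier ?P"
    show "?F (?F x) = x"
      by (rule ext) (simp_all add: x F F_coord Good_involutive[OF good] coord)
    fix y assume y: "y \<in> carrier ?P"
    show "?F (x \<star>\<^bsub>?P\<^esub> y) = ?F x \<star>\<^bsub>?P\<^esub> y"
      by (rule ext) (simp_all add: x y F P.closed F_coord op_coord Good_commute[OF good] coord)
    show "(x \<star>\<^bsub>?P\<^esub> ?F y) \<star>\<^bsub>?P\<^esub> y = x"
      by (rule ext) (simp_all add: x y F P.closed F_coord op_coord
          quandle.Good_cancel[OF quandle good] coord)
  qed
qed

text \<open>The coordinates other than \<open>j\<close> of a point act trivially on themselves, so moving only the
  \<open>j\<close>-th coordinate by \<open>d\<close> is a translation of the whole product, with which \<open>\<sigma>\<close> commutes. The values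
  at \<open>j\<close> that leave the \<open>i\<close>-th coordinate of the image unchanged thus form an invariant set.\<close>

lemma Good_product_change_coordinate:
  assumes quandle: "\<And>i. i \<in> I \<Longrightarrow> quandle (Q i)" and conn: "connected_quandle (Q j)"
    and \<sigma>: "\<sigma> \<in> Good (product_quandle I Q)" and x: "x \<in> carrier (product_quandle I Q)"
    and i: "i \<in> I" and j: "j \<in> I" "j \<noteq> i" and b: "b \<in> carrier (Q j)"
  shows "\<sigma> (x(j := b)) i = \<sigma> x i"
proof -
  let ?P = "product_quandle I Q"
  interpret P: quandle ?P using quandle_product quandle by blast
  interpret j: quandle "Q j" using quandle j by blast
  have upd: "x(j := c) \<in> carrier ?P" if "c \<in> carrier (Q j)" for c
    using x j(1) that by (auto simp: product_quandle_simps PiE_iff extensional_def)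
  have coord: "y k \<in> carrier (Q k)" if "y \<in> carrier ?P" "k \<in> I" for y k
    using that by (auto simp: product_quandle_simps)
  have move: "\<sigma> (x(j := c \<star>\<^bsub>Q j\<^esub> d)) i = \<sigma> (x(j := c)) i"
    if c: "c \<in> carrier (Q j)" and d: "d \<in> carrier (Q j)" for c d
  proof -
    have "x(j := c) \<star>\<^bsub>?P\<^esub> x(j := d) = x(j := c \<star>\<^bsub>Q j\<^esub> d)"
    proof (rule PiE_ext)
      show "x(j := c) \<star>\<^bsub>?P\<^esub> x(j := d) \<in> (\<Pi>\<^sub>E i\<in>I. carrier (Q i))"
        using P.closed[OF upd[OF c] upd[OF d]] by (simp add: product_quandle_simps(1))
      show "x(j := c \<star>\<^bsub>Q j\<^esub> d) \<in> (\<Pi>\<^sub>E i\<in>I. carrier (Q i))"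
        using upd[OF j.closed[OF c d]] by (simp add: product_quandle_simps(1))
      show "(x(j := c) \<star>\<^bsub>?P\<^esub> x(j := d)) k = (x(j := c \<star>\<^bsub>Q j\<^esub> d)) k" if "k \<in> I" for k
        using quandle.idem[OF quandle[OF that] coord[OF x that]] that
        by (simp add: product_quandle_simps(2))
    qed
    then have "\<sigma> (x(j := c \<star>\<^bsub>Q j\<^esub> d)) i = (\<sigma> (x(j := c)) \<star>\<^bsub>?P\<^esub> x(j := d)) i"
      using Good_commute[OF \<sigma> upd[OF c] upd[OF d]] by simp
    \<comment> \<open>The two acting points differ only at \<open>j\<close>, which the \<open>i\<close>-th coordinate does not see.\<close>
    also have "\<dots> = (\<sigma> (x(j := c)) \<star>\<^bsub>?P\<^esub> x(j := c)) i"
      using i j by (simp add: product_quandle_simps(2))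
    \<comment> \<open>A point \<open>z\<close> fixes its own image: \<open>\<sigma> z \<star> z = \<sigma> (z \<star> z) = \<sigma> z\<close>.\<close>
    also have "\<dots> = \<sigma> (x(j := c)) i"
      using Good_commute[OF \<sigma> upd[OF c] upd[OF c]] P.idem[OF upd[OF c]] by simp
    finally show ?thesis .
  qed
  have "b \<in> {c. \<sigma> (x(j := c)) i = \<sigma> x i}"
    by (rule connected_quandle_invariant_set[OF quandle[OF j(1)] conn _ coord[OF x j(1)] _ b])
       (simp_all add: move)
  then show ?thesis by simp
qed

lemma Good_product_componentwise:
  assumes "finite I" and quandle: "\<And>i. i \<in> I \<Longrightarrow> quandle (Q i)"
    and conn: "\<And>i. i \<in> I \<Longrightarrow> connected_quandle (Q i)"
    and \<sigma>: "\<sigma> \<in> Good (product_quandle I Q)"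
    and x: "x \<in> carrier (product_quandle I Q)" and y: "y \<in> carrier (product_quandle I Q)"
    and i: "i \<in> I" and eq: "x i = y i"
  shows "\<sigma> x i = \<sigma> y i"
proof -
  have mixed: "override_on x y J \<in> carrier (product_quandle I Q)" for J
    using x y by (auto simp: product_quandle_simps PiE_iff extensional_def override_on_def)
  have "\<sigma> (override_on x y J) i = \<sigma> x i" if "finite J" "J \<subseteq> I - {i}" for J
    using that
  proof (induction J)
    case (insert j J)
    then have j: "j \<in> I" "j \<noteq> i" by auto
    then have "y j \<in> carrier (Q j)" using y by (auto simp: product_quandle_simps)
    then have "\<sigma> ((override_on x y J)(j := y j)) i = \<sigma> (override_on x y J) i"
      using Good_product_change_coordinate[OF quandle conn[OF j(1)] \<sigma> mixed i j] by blast
    then show ?case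
      using insert.IH insert.prems by (metis override_on_insert insert_subset)
  qed (simp add: override_on_emptyset)
  then have "\<sigma> (override_on x y (I - {i})) i = \<sigma> x i"
    using \<open>finite I\<close> by simp
  moreover have "override_on x y (I - {i}) = y"
    using x y eq by (auto simp: fun_eq_iff override_on_def product_quandle_simps PiE_iff extensional_def)
  ultimately show ?thesis by simp
qed

text \<open>A base point \<open>e\<close> embeds \<open>Q i\<close> into the product as the points that agree with \<open>e\<close> away
  from \<open>i\<close>. The image of such a point need not be of this form, but its \<open>i\<close>-th coordinate
  defines a map on \<open>Q i\<close>, whose values do not depend on \<open>e\<close> by the previous lemma.\<close>

lemma Good_product_component:
  assumes "finite I" and quandle: "\<And>i. i \<in> I \<Longrightarrow> quandle (Q i)"
    and conn: "\<And>i. i \<in> I \<Longrightarrow> connected_quandle (Q i)"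
    and \<sigma>: "\<sigma> \<in> Good (product_quandle I Q)"
    and e: "e \<in> carrier (product_quandle I Q)" and i: "i \<in> I"
  shows "(\<lambda>a \<in> carrier (Q i). \<sigma> (e(i := a)) i) \<in> Good (Q i)"
proof -
  let ?P = "product_quandle I Q"
  interpret P: quandle ?P using quandle_product quandle by blast
  interpret i: quandle "Q i" using quandle i by blast
  define \<tau> where "\<tau> a = \<sigma> (e(i := a)) i" for a
  have upd: "e(i := a) \<in> carrier ?P" if "a \<in> carrier (Q i)" for a
    using e i that by (auto simp: product_quandle_simps PiE_iff extensional_def)
  have coord: "x i \<in> carrier (Q i)" if "x \<in> carrier ?P" for x
    using that i by (auto simp: product_quandle_simps)
  have \<sigma>_coord: "\<sigma> x i = \<tau> (x i)" if "x \<in> carrier ?P" for x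
    unfolding \<tau>_def
    by (rule Good_product_componentwise[OF \<open>finite I\<close> quandle conn \<sigma> that upd[OF coord[OF that]] i]) simp_all
  have op_coord: "(x \<star>\<^bsub>?P\<^esub> y) i = x i \<star>\<^bsub>Q i\<^esub> y i" for x y
    using i by (simp add: product_quandle_simps)
  have closed: "\<tau> a \<in> carrier (Q i)" if "a \<in> carrier (Q i)" for a
    unfolding \<tau>_def using coord Good_closed[OF \<sigma> upd[OF that]] .
  have invol: "\<tau> (\<tau> a) = a" if a: "a \<in> carrier (Q i)" for a
  proof -
    have "\<tau> (\<tau> a) = \<sigma> (\<sigma> (e(i := a))) i"
      using \<sigma>_coord[OF Good_closed[OF \<sigma> upd[OF a]]] by (simp add: \<tau>_def)
    then show ?thesis
      using Good_involutive[OF \<sigma> upd[OF a]] by simp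
  qed
  have commute: "\<tau> (a \<star>\<^bsub>Q i\<^esub> b) = \<tau> a \<star>\<^bsub>Q i\<^esub> b" if a: "a \<in> carrier (Q i)" and b: "b \<in> carrier (Q i)" for a b
  proof -
    have "\<tau> (a \<star>\<^bsub>Q i\<^esub> b) = \<sigma> (e(i := a) \<star>\<^bsub>?P\<^esub> e(i := b)) i"
      using \<sigma>_coord[OF P.closed[OF upd[OF a] upd[OF b]]] by (simp add: op_coord)
    also have "\<dots> = \<tau> a \<star>\<^bsub>Q i\<^esub> b"
      using Good_commute[OF \<sigma> upd[OF a] upd[OF b]] by (simp add: op_coord \<tau>_def)
    finally show ?thesis .
  qed
  have cancel: "(a \<star>\<^bsub>Q i\<^esub> \<tau> b) \<star>\<^bsub>Q i\<^esub> b = a" if a: "a \<in> carrier (Q i)" and b: "b \<in> carrier (Q i)" for a b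
    using arg_cong[OF P.Good_cancel[OF \<sigma> upd[OF a] upd[OF b]], of "\<lambda>x. x i"]
    by (simp add: op_coord \<tau>_def)
  show ?thesis
    unfolding \<tau>_def[symmetric] i.Good_iff
    using closed invol commute cancel i.closed by auto
qed

theorem family_to_product_bij:
  assumes "finite I" and quandle: "\<And>i. i \<in> I \<Longrightarrow> quandle (Q i)"
    and nonempty: "\<And>i. i \<in> I \<Longrightarrow> carrier (Q i) \<noteq> {}"
    and conn: "\<And>i. i \<in> I \<Longrightarrow> connected_quandle (Q i)"
  shows "bij_betw (family_to_product I Q) (\<Pi>\<^sub>E i\<in>I. Good (Q i)) (Good (product_quandle I Q))"
proof -
  let ?P = "product_quandle I Q"
  have "carrier ?P \<noteq> {}"
    using nonempty by (simp add: product_quandle_simps PiE_eq_empty_iff)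
  then obtain e where e: "e \<in> carrier ?P" by auto
  have upd: "e(i := a) \<in> carrier ?P" if "i \<in> I" "a \<in> carrier (Q i)" for i a
    using e that by (auto simp: product_quandle_simps PiE_iff extensional_def)
  let ?G = "\<lambda>\<sigma>. \<lambda>i\<in>I. \<lambda>a\<in>carrier (Q i). \<sigma> (e(i := a)) i"
  show ?thesis
  proof (rule bij_betwI[where g = ?G])
    show "family_to_product I Q \<in> (\<Pi>\<^sub>E i\<in>I. Good (Q i)) \<rightarrow> Good ?P"
      using family_to_product_Good quandle by blast
    show "?G \<in> Good ?P \<rightarrow> (\<Pi>\<^sub>E i\<in>I. Good (Q i))"
      using Good_product_component[OF \<open>finite I\<close> quandle conn _ e] by auto
    show "?G (family_to_product I Q \<rho>) = \<rho>" if \<rho>: "\<rho> \<in> (\<Pi>\<^sub>E i\<in>I. Good (Q i))" for \<rho>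
    proof
      fix i
      show "?G (family_to_product I Q \<rho>) i = \<rho> i"
      proof (cases "i \<in> I")
        case True
        then have "\<rho> i \<in> extensional (carrier (Q i))"
          using \<rho> by (auto simp: Good_def PiE_def Pi_def)
        then show ?thesis
          using True by (auto simp: family_to_product_apply upd extensional_def fun_eq_iff)
      next
        case False
        then show ?thesis using \<rho> by auto
      qed
    qed
    show "family_to_product I Q (?G \<sigma>) = \<sigma>" if \<sigma>: "\<sigma> \<in> Good ?P" for \<sigma>
    proof (rule extensionalityI[where A = "carrier ?P"])
      show "\<sigma> \<in> extensional (carrier ?P)"
        using \<sigma> by (simp add: Good_def PiE_def)
      show "family_to_product I Q (?G \<sigma>) \<in> extensional (carrier ?P)"
        by (simp add: family_to_product_def)
      fix x assume x: "x \<in> carrier ?P"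
      show "family_to_product I Q (?G \<sigma>) x = \<sigma> x"
      proof
        fix i
        show "family_to_product I Q (?G \<sigma>) x i = \<sigma> x i"
        proof (cases "i \<in> I")
          case True
          then have "x i \<in> carrier (Q i)" using x by (auto simp: product_quandle_simps)
          then show ?thesis
            using Good_product_componentwise[OF \<open>finite I\<close> quandle conn \<sigma> upd x True] True x
            by (simp add: family_to_product_apply)
        next
          case False
          moreover have "\<sigma> x \<in> extensional I"
            using Good_closed[OF \<sigma> x] by (auto simp: product_quandle_simps PiE_def)
          ultimately show ?thesis
            using x by (simp add: family_to_product_apply extensional_def)
        qed
      qed
    qed
  qed
qed

section \<open>The canonical bijections\<close>

lemma union_to_product_family_to_union:
  "union_to_product I Q (family_to_union I Q \<rho>) = family_to_product I Q \<rho>"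
proof -
  have "(\<lambda>i\<in>I. snd (family_to_union I Q \<rho> (i, x i))) = (\<lambda>i\<in>I. \<rho> i (x i))"
    if "x \<in> carrier (product_quandle I Q)" for x
  proof (rule restrict_ext)
    fix i assume "i \<in> I"
    moreover from this have "x i \<in> carrier (Q i)"
      using that by (auto simp: product_quandle_simps(1))
    ultimately show "snd (family_to_union I Q \<rho> (i, x i)) = \<rho> i (x i)"
      by (simp add: family_to_union_apply)
  qed
  then show ?thesis
    unfolding union_to_product_def family_to_product_def by (rule restrict_ext)
qed

theorem corollary1p5:
  fixes n :: nat and Q :: "nat \<Rightarrow> 'a quandle_struct"
  assumes "\<And>i. i \<in> {1..n} \<Longrightarrow> quandle (Q i)"
    and "\<And>i. i \<in> {1..n} \<Longrightarrow> \<not> trivial_quandle (Q i)"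
    and "\<And>i. i \<in> {1..n} \<Longrightarrow> connected_quandle (Q i)"
  shows "bij_betw (union_to_product {1..n} Q) (Good (free_union {1..n} Q)) (Good (product_quandle {1..n} Q))
    \<and> bij_betw (family_to_product {1..n} Q) (\<Pi>\<^sub>E i\<in>{1..n}. Good (Q i)) (Good (product_quandle {1..n} Q))
    \<and> bij_betw (family_to_union {1..n} Q) (\<Pi>\<^sub>E i\<in>{1..n}. Good (Q i)) (Good (free_union {1..n} Q))
    \<and> (\<forall>\<rho> \<in> (\<Pi>\<^sub>E i\<in>{1..n}. Good (Q i)).
         union_to_product {1..n} Q (family_to_union {1..n} Q \<rho>) = family_to_product {1..n} Q \<rho>)"
proof -
  have union: "bij_betw (family_to_union {1..n} Q) (\<Pi>\<^sub>E i\<in>{1..n}. Good (Q i)) (Good (free_union {1..n} Q))"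
    using family_to_union_bij assms by blast
  have product: "bij_betw (family_to_product {1..n} Q) (\<Pi>\<^sub>E i\<in>{1..n}. Good (Q i)) (Good (product_quandle {1..n} Q))"
    by (rule family_to_product_bij) (use assms nontrivial_quandle_nonempty in auto)
  have "union_to_product {1..n} Q \<circ> family_to_union {1..n} Q = family_to_product {1..n} Q"
    by (simp add: fun_eq_iff union_to_product_family_to_union)
  then have "bij_betw (union_to_product {1..n} Q) (Good (free_union {1..n} Q)) (Good (product_quandle {1..n} Q))"
    using bij_betw_comp_iff[OF union] product by metis
  then show ?thesis
    using union product union_to_product_family_to_union by blast
qed

end
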